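(* Let $n>0$ be a real number. Then for all real $t\ge 0$, $$S_{n,0}(t)^2\le \frac{2\exp\left(\sqrt{1+16n^2t^2}-1-4nt\right)}{1+\sqrt{1+16n^2t^2}}.$$
   Context: For real $n>0$, integers $k\ge0$ and $x\ge 0$, let $p_{n,k}^{[0]}(x):=\frac{(nx)^k}{k!}e^{-nx}$ (with $0^0=1$), the Poisson distribution with parameter $nx$. Its index of coincidence is $S_{n,0}(x):=\sum_{k=0}^\infty\left(p_{n,k}^{[0]}(x)\right)^2$, $x\ge 0$. *)

theory Defs
  imports Complex_Main
begin

text \<open>At \<open>n * x = 0\<close> the convention \<open>0 ^ 0 = 1\<close> is the library's own.\<close>

definition poisson_p :: "real \<Rightarrow> nat \<Rightarrow> real \<Rightarrow> real" where
  "poisson_p n k x = (n * x) ^ k / fact k * exp (- n * x)"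

definition index_of_coincidence :: "real \<Rightarrow> real \<Rightarrow> real" where
  "index_of_coincidence n x = (\<Sum>k. (poisson_p n k x)\<^sup>2)"

text \<open>The series converges, so the \<open>suminf\<close> above is its genuine sum.\<close>

lemma summable_poisson_p_squared: "summable (\<lambda>k. (poisson_p n k x)\<^sup>2)"
proof (rule summable_comparison_test')
  show "summable (\<lambda>k. exp (- n * x) ^ 2 * (inverse (fact k) * ((n * x)\<^sup>2) ^ k))"
    by (intro summable_mult summable_exp)
  fix k :: nat
  have "inverse (fact k * fact k) \<le> inverse (fact k :: real)"
    by (intro le_imp_inverse_le) (simp_all add: fact_ge_1)
  then have "exp (- n * x) ^ 2 * (inverse (fact k * fact k) * ((n * x)\<^sup>2) ^ k)
      \<le> exp (- n * x) ^ 2 * (inverse (fact k) * ((n * x)\<^sup>2) ^ k)"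
    by (intro mult_left_mono mult_right_mono) simp_all
  moreover have "(poisson_p n k x)\<^sup>2
      = exp (- n * x) ^ 2 * (inverse (fact k * fact k) * ((n * x)\<^sup>2) ^ k)"
    by (simp add: poisson_p_def power_mult_distrib power_divide power2_eq_square field_simps)
  ultimately show "norm ((poisson_p n k x)\<^sup>2)
      \<le> exp (- n * x) ^ 2 * (inverse (fact k) * ((n * x)\<^sup>2) ^ k)"
    by simp
qed

end

theory Submission
  imports Defs
begin

text \<open>
  Let \<open>f u = (\<Sum>k. u ^ k / (k!)\<^sup>2)\<close>, so that \<open>index_of_coincidence n t = exp (- 2 n t) * f ((n t)\<^sup>2)\<close>
  (\<open>f (y\<^sup>2)\<close> is the modified Bessel value \<open>I\<^sub>0 (2 y)\<close>).
  From the equation \<open>u f'' + f' = f\<close> one finds that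
  \<open>y \<mapsto> y (2 f\<^sup>2 - 2 y\<^sup>2 f'\<^sup>2 - f f') (y\<^sup>2)\<close> has derivative \<open>(f f') (y\<^sup>2) \<ge> 0\<close>
  and vanishes at \<open>0\<close>. Hence \<open>2 u f'\<^sup>2 + f f' \<le> 2 f\<^sup>2\<close>, which solves to
  \<open>f' / f \<le> 4 / (1 + sqrt (1 + 16 u))\<close>.
  Integrating this bound from \<open>0\<close> gives the claim, with equality at \<open>0\<close>.
\<close>

text \<open>The coefficients form a sequence of their own so that \<open>diffs\<close> supplies the
  power series of the derivatives.\<close>

definition bessel_coeff :: "nat \<Rightarrow> real" where
  "bessel_coeff k = inverse ((fact k)\<^sup>2)"

definition bessel :: "real \<Rightarrow> real" where
  "bessel u = (\<Sum>k. bessel_coeff k * u ^ k)"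

definition bessel' :: "real \<Rightarrow> real" where
  "bessel' u = (\<Sum>k. diffs bessel_coeff k * u ^ k)"

definition bessel'' :: "real \<Rightarrow> real" where
  "bessel'' u = (\<Sum>k. diffs (diffs bessel_coeff) k * u ^ k)"

lemma summable_bessel: "summable (\<lambda>k. bessel_coeff k * u ^ k)"
proof (rule summable_comparison_test')
  show "summable (\<lambda>k. inverse (fact k) * \<bar>u\<bar> ^ k)"
    by (rule summable_exp)
  fix k :: nat
  have "1 * (fact k :: real) \<le> fact k * fact k"
    by (intro mult_right_mono fact_ge_1) simp
  then have "bessel_coeff k \<le> inverse (fact k)"
    unfolding bessel_coeff_def by (intro le_imp_inverse_le) (simp_all add: power2_eq_square)
  then show "norm (bessel_coeff k * u ^ k) \<le> inverse (fact k) * \<bar>u\<bar> ^ k"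
    by (simp add: bessel_coeff_def abs_mult power_abs mult_right_mono)
qed

lemma summable_bessel': "summable (\<lambda>k. diffs bessel_coeff k * u ^ k)"
  by (rule termdiff_converges_all) (rule summable_bessel)

lemma summable_bessel'': "summable (\<lambda>k. diffs (diffs bessel_coeff) k * u ^ k)"
  by (rule termdiff_converges_all) (rule summable_bessel')

lemma DERIV_bessel: "(bessel has_real_derivative bessel' u) (at u)"
  unfolding bessel_def [abs_def] bessel'_def
  by (rule termdiffs_strong_converges_everywhere) (rule summable_bessel)

lemma DERIV_bessel': "(bessel' has_real_derivative bessel'' u) (at u)"
  unfolding bessel'_def [abs_def] bessel''_def
  by (rule termdiffs_strong_converges_everywhere) (rule summable_bessel')

text \<open>Comparing coefficients of \<open>u ^ k\<close>, this is
  \<open>(k + 1)\<^sup>2 * bessel_coeff (k + 1) = bessel_coeff k\<close>.\<close>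

lemma bessel_ode: "u * bessel'' u + bessel' u = bessel u"
proof -
  let ?d = "diffs bessel_coeff"
  have "(\<lambda>k. of_nat k * ?d k * u ^ (k - Suc 0)) sums bessel'' u"
    unfolding bessel''_def by (rule diffs_equiv) (rule summable_bessel'')
  then have "(\<lambda>k. u * (of_nat k * ?d k * u ^ (k - Suc 0))) sums (u * bessel'' u)"
    by (rule sums_mult)
  moreover have "(\<lambda>k. ?d k * u ^ k) sums bessel' u"
    unfolding bessel'_def by (intro summable_sums summable_bessel')
  ultimately have "(\<lambda>k. u * (of_nat k * ?d k * u ^ (k - Suc 0)) + ?d k * u ^ k)
      sums (u * bessel'' u + bessel' u)"
    by (rule sums_add)
  moreover have "u * (of_nat k * ?d k * u ^ (k - Suc 0)) + ?d k * u ^ k = bessel_coeff k * u ^ k"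
    for k
  proof -
    \<comment> \<open>For \<open>k = 0\<close> the truncated exponent does no harm, as the factor
      \<open>of_nat k\<close> vanishes.\<close>
    have "u * (of_nat k * ?d k * u ^ (k - Suc 0)) = of_nat k * ?d k * u ^ k"
      by (cases k) simp_all
    moreover have "of_nat k * ?d k + ?d k = bessel_coeff k"
      by (simp add: diffs_def bessel_coeff_def power2_eq_square divide_simps del: of_nat_Suc)
    ultimately show ?thesis
      by (metis distrib_right)
  qed
  ultimately have "(\<lambda>k. bessel_coeff k * u ^ k) sums (u * bessel'' u + bessel' u)"
    by simp
  then show ?thesis
    by (simp add: bessel_def sums_iff)
qed

lemma bessel_0: "bessel 0 = 1" "bessel' 0 = 1"
  by (simp_all add: bessel_def bessel'_def bessel_coeff_def diffs_def)

lemma bessel_pos: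
  assumes "u \<ge> 0"
  shows "bessel u > 0"
  unfolding bessel_def
  by (rule suminf_pos2 [where i = 0, OF summable_bessel])
    (use assms in \<open>simp_all add: bessel_coeff_def\<close>)

lemma bessel'_nonneg:
  assumes "u \<ge> 0"
  shows "bessel' u \<ge> 0"
  unfolding bessel'_def
  by (rule suminf_nonneg [OF summable_bessel'])
    (use assms in \<open>simp add: bessel_coeff_def diffs_def\<close>)

lemma bessel_quadratic_ineq:
  assumes "u \<ge> 0"
  shows "2 * u * (bessel' u)\<^sup>2 + bessel u * bessel' u \<le> 2 * (bessel u)\<^sup>2"
\<comment> \<open>The general argument ends by cancelling a factor \<open>sqrt u\<close>, so
  \<open>u = 0\<close> is checked directly.\<close>
proof (cases "u = 0")
  case True
  then show ?thesis by (simp add: bessel_0)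
next
  case False
  with assms have "u > 0" by simp
  \<comment> \<open>Substituting \<open>u = y\<^sup>2\<close> avoids differentiating
    \<open>sqrt\<close> at \<open>0\<close>.\<close>
  define H where "H y = y * (2 * (bessel (y\<^sup>2))\<^sup>2 - 2 * y\<^sup>2 * (bessel' (y\<^sup>2))\<^sup>2
    - bessel (y\<^sup>2) * bessel' (y\<^sup>2))" for y
  have deriv: "(H has_real_derivative bessel (y\<^sup>2) * bessel' (y\<^sup>2)) (at y)" for y
  proof -
    let ?f = "bessel (y\<^sup>2)" and ?g = "bessel' (y\<^sup>2)" and ?h = "bessel'' (y\<^sup>2)"
    note [derivative_intros] = DERIV_chain2 [OF DERIV_bessel] DERIV_chain2 [OF DERIV_bessel']
    let ?D = "(2 * ?f\<^sup>2 - 2 * y\<^sup>2 * ?g\<^sup>2 - ?f * ?g)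
        + y * (4 * ?f * ?g * (2 * y) - 4 * y * ?g\<^sup>2 - 4 * y\<^sup>2 * ?g * ?h * (2 * y)
          - (?g * (2 * y) * ?g + ?f * ?h * (2 * y)))"
    have "(H has_real_derivative ?D) (at y)"
      unfolding H_def
      by (auto intro!: derivative_eq_intros simp: algebra_simps power2_eq_square)
    \<comment> \<open>The subtracted term is a multiple of the residual of the differential equation
      at \<open>y\<^sup>2\<close>, hence zero.\<close>
    moreover have "?D = ?f * ?g - (8 * y\<^sup>2 * ?g + 2 * ?f) * (y\<^sup>2 * ?h + ?g - ?f)"
      by (simp add: algebra_simps power2_eq_square)
    ultimately show ?thesis
      by (simp only: bessel_ode diff_self mult_zero_right diff_zero)
  qed
  have "H 0 \<le> H (sqrt u)"
  proof (rule DERIV_nonneg_imp_nondecreasing [of 0 "sqrt u" H])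
    show "0 \<le> sqrt u" using assms by simp
    fix y :: real
    have "bessel (y\<^sup>2) * bessel' (y\<^sup>2) \<ge> 0"
      by (simp add: bessel_pos bessel'_nonneg less_imp_le)
    with deriv show "\<exists>d. (H has_real_derivative d) (at y) \<and> 0 \<le> d"
      by blast
  qed
  then show ?thesis
    using \<open>u > 0\<close> by (simp add: H_def zero_le_mult_iff)
qed

text \<open>Eight times the quadratic inequality, completed to a square, reads
  \<open>(1 + 16 * u) * g\<^sup>2 \<le> (4 * f - g)\<^sup>2\<close>, where \<open>f\<close> and
  \<open>g\<close> are the values of \<open>bessel\<close> and \<open>bessel'\<close> at
  \<open>u\<close>; then take square roots.\<close>

lemma bessel_log_derivative_le:
  assumes "u \<ge> 0"
  shows "bessel' u / bessel u \<le> 4 / (1 + sqrt (1 + 16 * u))"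
proof -
  let ?f = "bessel u" and ?g = "bessel' u" and ?s = "sqrt (1 + 16 * u)"
  have f: "?f > 0" and g: "?g \<ge> 0"
    using assms by (simp_all add: bessel_pos bessel'_nonneg)
  note quad = bessel_quadratic_ineq [OF assms]
  \<comment> \<open>Dropping this term gives the crude bound \<open>?g \<le> 2 * ?f\<close>, which
    settles the sign of \<open>4 * ?f - ?g\<close> for the square root.\<close>
  have "2 * u * ?g\<^sup>2 \<ge> 0" using assms by simp
  with quad have "?f * ?g \<le> ?f * (2 * ?f)"
    by (simp add: power2_eq_square)
  with f have "?g \<le> 2 * ?f" by simp
  then have "0 \<le> 4 * ?f - ?g" using f by simp
  moreover have "(?s * ?g)\<^sup>2 \<le> (4 * ?f - ?g)\<^sup>2"
    using quad assms by (simp add: power_mult_distrib power2_eq_square algebra_simps)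
  ultimately have "?s * ?g \<le> 4 * ?f - ?g"
    by (metis power2_le_imp_le)
  moreover have "1 + ?s > 0"
    using assms by (intro add_pos_nonneg) simp_all
  ultimately show ?thesis
    using f by (simp add: field_simps)
qed

lemma bessel_squared_le:
  assumes "u \<ge> 0"
  shows "(bessel u)\<^sup>2 \<le> 2 * exp (sqrt (1 + 16 * u) - 1) / (1 + sqrt (1 + 16 * u))"
proof -
  \<comment> \<open>Up to an additive constant, \<open>Q\<close> is the logarithm of the quotient of
    the two sides, which agree at \<open>0\<close>.\<close>
  define Q where "Q x = 2 * ln (bessel x) - sqrt (1 + 16 * x) + ln (1 + sqrt (1 + 16 * x))" for x
  have spos: "1 + sqrt (1 + 16 * x) > 0" if "x \<ge> 0" for x
    using that by (intro add_pos_nonneg) simp_all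
  have "Q u \<le> Q 0"
  proof (rule DERIV_nonpos_imp_nonincreasing [of 0 u Q, OF assms])
    fix x :: real
    assume "0 \<le> x"
    let ?s = "sqrt (1 + 16 * x)"
    have s: "?s > 0" and f: "bessel x > 0"
      using \<open>0 \<le> x\<close> by (simp_all add: bessel_pos)
    have "((\<lambda>x. 1 + 16 * x) has_real_derivative 16) (at x)"
      by (auto intro!: derivative_eq_intros)
    then have "((\<lambda>x. sqrt (1 + 16 * x)) has_real_derivative inverse ?s / 2 * 16) (at x)"
      using s by (intro DERIV_chain2 [where f = sqrt] DERIV_real_sqrt) simp_all
    moreover have "inverse ?s / 2 * 16 = 8 / ?s"
      by (simp only: divide_inverse) simp
    ultimately have d_sqrt: "((\<lambda>x. sqrt (1 + 16 * x)) has_real_derivative 8 / ?s) (at x)"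
      by (simp only:)
    have d_ln: "((\<lambda>x. ln (bessel x)) has_real_derivative 1 / bessel x * bessel' x) (at x)"
      by (rule DERIV_chain2 [OF DERIV_ln_divide [OF f] DERIV_bessel])
    have "((\<lambda>x. ln (1 + sqrt (1 + 16 * x))) has_real_derivative 1 / (1 + ?s) * (0 + 8 / ?s)) (at x)"
      by (rule DERIV_chain2 [OF DERIV_ln_divide [OF spos [OF \<open>0 \<le> x\<close>]]
            DERIV_add [OF DERIV_const d_sqrt]])
    then have d_Q: "(Q has_real_derivative
        2 * (1 / bessel x * bessel' x) - 8 / ?s + 1 / (1 + ?s) * (0 + 8 / ?s)) (at x)"
      unfolding Q_def by (intro DERIV_add DERIV_diff DERIV_cmult d_ln d_sqrt)
    \<comment> \<open>With \<open>r = ?s\<close>: the derivative of \<open>s - ln (1 + s)\<close>,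
      for \<open>s = sqrt (1 + 16 * x)\<close>, is exactly twice the bound on the logarithmic
      derivative of \<open>bessel\<close>.\<close>
    have "8 / r - 1 / (1 + r) * (0 + 8 / r) = 2 * (4 / (1 + r))" if "r > 0" for r :: real
      using that by (simp add: divide_simps)
    note this [OF s]
    moreover have "1 / bessel x * bessel' x \<le> 4 / (1 + ?s)"
      using bessel_log_derivative_le [OF \<open>0 \<le> x\<close>] by simp
    ultimately have "2 * (1 / bessel x * bessel' x) - 8 / ?s + 1 / (1 + ?s) * (0 + 8 / ?s) \<le> 0"
      by linarith
    with d_Q show "\<exists>d. (Q has_real_derivative d) (at x) \<and> d \<le> 0"
      by blast
  qed
  then have "2 * ln (bessel u) \<le> ln 2 + (sqrt (1 + 16 * u) - 1) - ln (1 + sqrt (1 + 16 * u))"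
    by (simp add: Q_def bessel_0)
  also have "\<dots> = ln (2 * exp (sqrt (1 + 16 * u) - 1) / (1 + sqrt (1 + 16 * u)))"
    using spos [OF assms] by (simp add: ln_div ln_mult)
  finally have "ln ((bessel u)\<^sup>2) \<le> \<dots>"
    using bessel_pos [OF assms] by (simp add: ln_realpow)
  then show ?thesis
    using bessel_pos [OF assms] spos [OF assms] by (subst (asm) ln_le_cancel_iff) simp_all
qed

text \<open>In each squared Poisson weight the exponential factor is independent of \<open>k\<close>
  and leaves the sum.\<close>

lemma index_of_coincidence_eq_bessel:
  "index_of_coincidence n t = exp (- 2 * n * t) * bessel ((n * t)\<^sup>2)"
proof -
  have "(poisson_p n k t)\<^sup>2 = exp (- 2 * n * t) * (bessel_coeff k * ((n * t)\<^sup>2) ^ k)" for k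
  proof -
    have "(exp (- n * t))\<^sup>2 = exp (- 2 * n * t)"
      by (simp add: power2_eq_square flip: exp_add)
    moreover have "((n * t) ^ k)\<^sup>2 = ((n * t)\<^sup>2) ^ k"
      by (metis power_mult mult.commute)
    ultimately show ?thesis
      unfolding poisson_p_def bessel_coeff_def power_mult_distrib [of _ "exp _"] power_divide
      by (simp add: divide_inverse mult_ac)
  qed
  then show ?thesis
    by (simp add: index_of_coincidence_def bessel_def suminf_mult summable_bessel)
qed

theorem mainTheorem4:
  fixes n t :: real
  assumes "n > 0" and "t \<ge> 0"
  shows "(index_of_coincidence n t)\<^sup>2
    \<le> 2 * exp (sqrt (1 + 16 * n\<^sup>2 * t\<^sup>2) - 1 - 4 * n * t) / (1 + sqrt (1 + 16 * n\<^sup>2 * t\<^sup>2))"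
proof -
  let ?s = "sqrt (1 + 16 * n\<^sup>2 * t\<^sup>2)"
  have "(index_of_coincidence n t)\<^sup>2 = exp (- 4 * n * t) * (bessel ((n * t)\<^sup>2))\<^sup>2"
    by (simp add: index_of_coincidence_eq_bessel power_mult_distrib power2_eq_square flip: exp_add)
  also have "\<dots> \<le> exp (- 4 * n * t) * (2 * exp (?s - 1) / (1 + ?s))"
    using bessel_squared_le [of "(n * t)\<^sup>2"]
    by (intro mult_left_mono) (simp_all add: power_mult_distrib mult.assoc)
  also have "\<dots> = 2 * exp (?s - 1 - 4 * n * t) / (1 + ?s)"
    by (simp add: algebra_simps flip: exp_add)
  finally show ?thesis .
qed

end
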